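(* For every integer $k\geq 3$ let $E=C\sqcup D_1\sqcup\dots\sqcup D_{3k(2k-1)}$, where $C,D_1,\dots,D_{3k(2k-1)}$ are pairwise disjoint sets, $C$ has $k(2k-1)$ elements and each $D_i$ has $k$ elements. Let $M_k$ be the transversal matroid on the ground set $E$ given by the multiset $\mathcal{A}_k$ of subsets of $E$ consisting of the sets $D_1,\dots,D_{3k(2k-1)}$ and $2k-1$ copies of $E$. Then $\chi(M_k)=k$ and $\chi_g(M_k)\geq 2k-1$.
   Context: The transversal matroid on a finite set $E$ given by a multiset $\mathcal{A}=\{A_j:j\in J\}$ of subsets of $E$ has as independent sets exactly those $A\subset E$ for which there exists an injection $\phi:A\to J$ with $a\in A_{\phi(a)}$ for every $a\in A$. For a loopless matroid $M$ the chromatic number $\chi(M)$ is the minimum number of independent sets into which the ground set can be partitioned. The game chromatic number $\chi_g(M)$ is the minimum size of a set of colors for which Alice has a winning strategy in the following game: Alice and Bob alternately (Alice moving first) color one uncolored element of the ground set with a color from the fixed set of colors, so that at any moment all elements of the same color form an independent set of $M$; the game ends when the whole ground set is colored (Alice wins) or when no uncolored element can be legally colored (Bob wins). *)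

theory Defs
  imports Main "HOL-Library.Disjoint_Sets"
begin

text \<open>A matroid is given by its ground set \<open>E\<close> together with its predicate \<open>indep\<close> of independent
  sets. A finite multiset of sets is given, with multiplicities, by an indexed family \<open>A\<close> over an
  index set \<open>J\<close>.\<close>

definition transversal_indep :: "'a set \<Rightarrow> 'j set \<Rightarrow> ('j \<Rightarrow> 'a set) \<Rightarrow> 'a set \<Rightarrow> bool" where
  "transversal_indep E J A X \<longleftrightarrow>
     X \<subseteq> E \<and> (\<exists>\<phi>. inj_on \<phi> X \<and> \<phi> ` X \<subseteq> J \<and> (\<forall>a\<in>X. a \<in> A (\<phi> a)))"

text \<open>Both numbers below are minima of nonempty sets, as intended, when the matroid is
  finite and loopless.\<close>

definition chromatic_number :: "'a set \<Rightarrow> ('a set \<Rightarrow> bool) \<Rightarrow> nat" where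
  "chromatic_number E indep =
     (LEAST n. \<exists>P. partition_on E P \<and> (\<forall>X\<in>P. indep X) \<and> finite P \<and> card P = n)"

text \<open>A position of the colouring game is its history: the list of moves made so far in
  chronological order, a move being a pair of an element and the colour it receives.
  Alice is to move exactly when the history has even length.\<close>

definition legal_move ::
    "'a set \<Rightarrow> ('a set \<Rightarrow> bool) \<Rightarrow> 'c set \<Rightarrow> ('a \<times> 'c) list \<Rightarrow> 'a \<times> 'c \<Rightarrow> bool" where
  "legal_move E indep K h m \<longleftrightarrow>
     fst m \<in> E \<and> fst m \<notin> fst ` set h \<and> snd m \<in> K \<and>
     indep {e. (e, snd m) \<in> set (h @ [m])}"

text \<open>Histories that can arise when Alice follows the strategy \<open>\<sigma>\<close>.\<close>

inductive_set plays ::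
    "'a set \<Rightarrow> ('a set \<Rightarrow> bool) \<Rightarrow> 'c set \<Rightarrow> (('a \<times> 'c) list \<Rightarrow> 'a \<times> 'c) \<Rightarrow> ('a \<times> 'c) list set"
  for E :: "'a set" and indep :: "'a set \<Rightarrow> bool" and K :: "'c set"
    and \<sigma> :: "('a \<times> 'c) list \<Rightarrow> 'a \<times> 'c"
where
  start: "[] \<in> plays E indep K \<sigma>"
| alice: "\<lbrakk>h \<in> plays E indep K \<sigma>; even (length h); legal_move E indep K h (\<sigma> h)\<rbrakk>
    \<Longrightarrow> h @ [\<sigma> h] \<in> plays E indep K \<sigma>"
| bob: "\<lbrakk>h \<in> plays E indep K \<sigma>; odd (length h); legal_move E indep K h m\<rbrakk>
    \<Longrightarrow> h @ [m] \<in> plays E indep K \<sigma>"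

text \<open>On a finite ground set every play ends, so Alice wins iff she never faces or leaves a
  position that is not completely coloured and admits no legal move. The strategy must
  itself supply a legal move on each of her turns.\<close>

definition winning_strategy ::
    "'a set \<Rightarrow> ('a set \<Rightarrow> bool) \<Rightarrow> 'c set \<Rightarrow> (('a \<times> 'c) list \<Rightarrow> 'a \<times> 'c) \<Rightarrow> bool" where
  "winning_strategy E indep K \<sigma> \<longleftrightarrow>
     (\<forall>h \<in> plays E indep K \<sigma>. fst ` set h \<noteq> E \<longrightarrow>
        (if even (length h) then legal_move E indep K h (\<sigma> h)
         else \<exists>m. legal_move E indep K h m))"

definition game_chromatic_number :: "'a set \<Rightarrow> ('a set \<Rightarrow> bool) \<Rightarrow> nat" where
  "game_chromatic_number E indep =
     (LEAST n. \<exists>K :: nat set. finite K \<and> card K = n \<and> (\<exists>\<sigma>. winning_strategy E indep K \<sigma>))"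

end

theory Submission
  imports Defs
begin

text \<open>
Write \<open>n = 2k - 1\<close>. A set \<open>X\<close> is independent iff \<open>card X\<close> exceeds the number of blocks \<open>D i\<close> that it
meets by at most \<open>n\<close> (\<open>indep_iff\<close>): one element of each block can be matched to that block, and
everything else, including all of \<open>X \<inter> C\<close>, has to share the \<open>n\<close> copies of the ground set. In
particular each colour class contains at most \<open>n\<close> elements of \<open>C\<close>, so the \<open>k * n\<close> elements of \<open>C\<close>
require \<open>k\<close> colours; giving the elements of each block different colours and distributing \<open>C\<close>
evenly shows that \<open>k\<close> colours suffice.

In the game with \<open>c \<le> 2k - 2\<close> colours, Bob wastes the copies of the ground set. An element of a
block that repeats a colour already present in that block occupies one unit of the total capacity
\<open>c * n\<close>, exactly as an element of \<open>C\<close> does. Hence the waste \<open>w\<close>, the number of such repetitions,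
satisfies \<open>w + k * n \<le> c * n\<close> in every complete colouring. It never decreases, so under a winning
strategy of Alice this bound holds in all positions (\<open>waste_bound\<close>), whence \<open>w \<le> (k - 2) * n\<close>.
Call a colour full when its class already uses all of its \<open>n\<close> units.

Bob repeats a colour in some block whenever this is legal; otherwise he starts a block without
coloured elements, using a colour that is not full. Every move of Bob other than a start
increases the waste, so few starts are what he needs. When he has to start a block, every
colour in a block with uncoloured elements is full, for otherwise he could repeat it. So the
blocks that he started and that still have uncoloured elements have pairwise different starting
colours; there are at most \<open>c\<close> of them. Every other block that he started has all its \<open>k\<close>
elements coloured. If \<open>p\<close> and \<open>q \<le> c\<close> count the started blocks of the second and of the first
kind, \<open>b\<close> the moves of Bob, and \<open>d\<close> the coloured elements outside \<open>C\<close>, then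
\<open>b \<le> w + p + q\<close> and \<open>k * p + q \<le> d\<close>. While Alice has made at most one move more than Bob, these
inequalities force the number of coloured elements of \<open>C\<close> below \<open>k * n\<close> (\<open>free_part_arith\<close>): each
of her moves in \<open>C\<close> is answered by a move of Bob, of which all but roughly a fraction \<open>1 / k\<close> is
waste, and \<open>(k - 1) * n\<close> units of waste, even after a loss of less than \<open>n\<close>, are more than
\<open>(k - 2) * n\<close>. They also force fewer than \<open>3 * k * n\<close> blocks to meet the coloured set
(\<open>fresh_block_arith\<close>), so that Bob always finds a block to start. Thus \<open>C\<close> is never completely
coloured, Alice and Bob can move forever, and this is absurd in a finite ground set.
\<close>

section \<open>Histories of the colouring game\<close>

definition colour_class :: "('a \<times> 'c) list \<Rightarrow> 'c \<Rightarrow> 'a set" where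
  "colour_class h a = {e. (e, a) \<in> set h}"

abbreviation coloured :: "('a \<times> 'c) list \<Rightarrow> 'a set" where
  "coloured h \<equiv> fst ` set h"

lemma colour_class_snoc:
  "colour_class (h @ [m]) a = (if a = snd m then insert (fst m) (colour_class h a) else colour_class h a)"
  by (cases m) (auto simp: colour_class_def)

lemma legal_move_iff:
  "legal_move E indep K h m \<longleftrightarrow>
     fst m \<in> E \<and> fst m \<notin> coloured h \<and> snd m \<in> K \<and> indep (colour_class (h @ [m]) (snd m))"
  by (simp add: legal_move_def colour_class_def)

text \<open>An empty colour class is admitted separately because \<open>indep\<close> is arbitrary here and need not
  hold of the empty set.\<close>

definition proper_history ::
    "'a set \<Rightarrow> ('a set \<Rightarrow> bool) \<Rightarrow> 'c set \<Rightarrow> ('a \<times> 'c) list \<Rightarrow> bool" where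
  "proper_history E indep K h \<longleftrightarrow>
     distinct (map fst h) \<and> coloured h \<subseteq> E \<and> snd ` set h \<subseteq> K \<and>
     (\<forall>a. colour_class h a = {} \<or> indep (colour_class h a))"

lemma proper_history_snoc:
  assumes "proper_history E indep K h" "legal_move E indep K h m"
  shows "proper_history E indep K (h @ [m])"
  using assms unfolding proper_history_def legal_move_iff
  by (auto simp: colour_class_snoc)

lemma proper_history_plays: "h \<in> plays E indep K \<sigma> \<Longrightarrow> proper_history E indep K h"
proof (induction rule: plays.induct)
  case start
  show ?case by (simp add: proper_history_def colour_class_def)
qed (auto intro: proper_history_snoc)

lemma proper_history_card_coloured:
  "proper_history E indep K h \<Longrightarrow> card (coloured h) = length h"
  by (metis distinct_card length_map list.set_map proper_history_def)

lemma proper_history_card_set: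
  "proper_history E indep K h \<Longrightarrow> card (set h) = length h"
  by (metis distinct_card distinct_map proper_history_def)

lemma winning_strategy_extend:
  assumes "winning_strategy E indep K \<sigma>" "h \<in> plays E indep K \<sigma>" "coloured h \<noteq> E"
  obtains m where "legal_move E indep K h m" "h @ [m] \<in> plays E indep K \<sigma>"
proof (cases "even (length h)")
  case True
  then have "legal_move E indep K h (\<sigma> h)"
    using assms by (auto simp: winning_strategy_def)
  then show ?thesis using that plays.alice[OF assms(2) True] by blast
next
  case False
  then obtain m where "legal_move E indep K h m"
    using assms unfolding winning_strategy_def by (metis (lifting))
  then show ?thesis using that plays.bob[OF assms(2) False] by blast
qed

text \<open>The minimum defining the game chromatic number is taken over a nonempty set: with as many
  colours as elements, some colour is always unused, and a player may give it to any element.\<close>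

lemma winning_strategy_card_colours:
  assumes fin: "finite E" and loopless: "\<And>e. e \<in> E \<Longrightarrow> indep {e}"
  shows "\<exists>\<sigma>. winning_strategy E indep {..<card E} \<sigma>"
proof -
  let ?K = "{..<card E}"
  define \<sigma> where "\<sigma> h = (SOME m. legal_move E indep ?K h m)" for h
  have ex: "\<exists>m. legal_move E indep ?K h m" if h: "h \<in> plays E indep ?K \<sigma>" "coloured h \<noteq> E" for h
  proof -
    have p: "proper_history E indep ?K h" using proper_history_plays h(1) .
    then have sub: "coloured h \<subset> E" using h(2) by (auto simp: proper_history_def)
    then obtain e where e: "e \<in> E" "e \<notin> coloured h" by blast
    have "card (snd ` set h) \<le> length h"
      by (metis card_image_le card_length le_trans List.finite_set)
    also have "\<dots> < card E"
      using psubset_card_mono[OF fin sub] proper_history_card_coloured[OF p] by simp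
    finally have "card (snd ` set h) < card ?K" by simp
    then obtain a where a: "a \<in> ?K" "a \<notin> snd ` set h"
      by (metis card_mono finite_imageI linorder_not_le List.finite_set subsetI)
    have "colour_class (h @ [(e, a)]) a = {e}"
      using a(2) by (force simp: colour_class_def)
    then show ?thesis
      using e a(1) loopless by (intro exI[of _ "(e, a)"]) (simp add: legal_move_iff)
  qed
  have "winning_strategy E indep ?K \<sigma>"
    unfolding winning_strategy_def
    using ex by (auto simp: \<sigma>_def intro: someI_ex)
  then show ?thesis by blast
qed

section \<open>Transversal matroids of disjoint blocks and copies of the ground set\<close>

locale block_matroid =
  fixes C :: "'a set" and D :: "'i \<Rightarrow> 'a set" and I :: "'i set" and n :: nat
  assumes finite_C: "finite C" and finite_I: "finite I"
    and finite_D: "i \<in> I \<Longrightarrow> finite (D i)"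
    and disjoint_D: "disjoint_family_on D I"
    and disjoint_C_D: "i \<in> I \<Longrightarrow> C \<inter> D i = {}"
begin

definition ground :: "'a set" where
  "ground = C \<union> (\<Union>i\<in>I. D i)"

definition indep :: "'a set \<Rightarrow> bool" where
  "indep = transversal_indep ground (I <+> {1..n}) (case_sum D (\<lambda>_::nat. ground))"

definition touched :: "'a set \<Rightarrow> 'i set" where
  "touched X = {i \<in> I. X \<inter> D i \<noteq> {}}"

lemma finite_ground: "finite ground"
  using finite_C finite_I finite_D by (auto simp: ground_def)

lemma finite_touched: "finite (touched X)"
  using finite_I by (auto simp: touched_def)

lemma block_unique: "i \<in> I \<Longrightarrow> j \<in> I \<Longrightarrow> e \<in> D i \<Longrightarrow> e \<in> D j \<Longrightarrow> i = j"
  using disjoint_D by (auto simp: disjoint_family_on_def)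

text \<open>This is the form in which the matroid is used everywhere below. An injection into the indices
  gives each touched block at most one element and the copies of the ground set at most \<open>n\<close>;
  conversely, one representative of each touched block goes to that block and the others, at
  most \<open>n\<close>, go injectively to the copies.\<close>

lemma indep_iff: "indep X \<longleftrightarrow> X \<subseteq> ground \<and> card X \<le> n + card (touched X)"
proof
  assume "indep X"
  then obtain \<phi> where X: "X \<subseteq> ground" and inj: "inj_on \<phi> X"
    and ran: "\<phi> ` X \<subseteq> I <+> {1..n}"
    and mem: "\<And>x. x \<in> X \<Longrightarrow> x \<in> case_sum D (\<lambda>_. ground) (\<phi> x)"
    by (auto simp: indep_def transversal_indep_def)
  have "\<phi> ` X \<subseteq> touched X <+> {1..n}"
    using ran mem by (force simp: touched_def Plus_def)
  then have "card X \<le> card (touched X <+> {1..n})"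
    using inj finite_touched by (intro card_inj_on_le[of \<phi>]) auto
  then show "X \<subseteq> ground \<and> card X \<le> n + card (touched X)"
    using X by (simp add: card_Plus finite_touched)
next
  assume a: "X \<subseteq> ground \<and> card X \<le> n + card (touched X)"
  then have fX: "finite X" using finite_ground finite_subset by blast
  have "\<forall>i\<in>touched X. \<exists>x. x \<in> X \<inter> D i" by (auto simp: touched_def)
  then obtain r where r: "\<And>i. i \<in> touched X \<Longrightarrow> r i \<in> X \<inter> D i" by metis
  have injr: "inj_on r (touched X)"
    using r block_unique by (intro inj_onI) (metis (lifting) IntD2 mem_Collect_eq touched_def)
  let ?R = "r ` touched X"
  have "card (X - ?R) = card X - card ?R"
    using r by (intro card_Diff_subset) (auto simp: finite_touched)
  then have "card (X - ?R) \<le> card {1..n}"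
    using a card_image[OF injr] by (simp add: le_diff_conv add.commute)
  then obtain \<psi> where \<psi>: "\<psi> ` (X - ?R) \<subseteq> {1..n}" "inj_on \<psi> (X - ?R)"
    using card_le_inj[of "X - ?R" "{1..n}"] fX by auto
  define \<phi> where "\<phi> x = (if x \<in> ?R then Inl (the_inv_into (touched X) r x) else Inr (\<psi> x))" for x
  have rep: "\<phi> (r i) = Inl i" if "i \<in> touched X" for i
    using that by (simp add: \<phi>_def the_inv_into_f_f[OF injr])
  have "inj_on \<phi> X"
  proof (rule inj_onI)
    fix x y assume xy: "x \<in> X" "y \<in> X" "\<phi> x = \<phi> y"
    show "x = y"
    proof (cases "x \<in> ?R"; cases "y \<in> ?R")
      assume "x \<in> ?R" "y \<in> ?R"
      then show ?thesis using xy(3) rep by auto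
    next
      assume "x \<notin> ?R" "y \<notin> ?R"
      then show ?thesis using xy \<psi>(2) by (auto simp: \<phi>_def inj_on_def)
    qed (use xy(3) in \<open>auto simp: \<phi>_def\<close>)
  qed
  moreover have "\<phi> x \<in> I <+> {1..n} \<and> x \<in> case_sum D (\<lambda>_. ground) (\<phi> x)" if x: "x \<in> X" for x
  proof (cases "x \<in> ?R")
    case True
    then obtain i where "i \<in> touched X" "x = r i" by blast
    then show ?thesis using rep r by (auto simp: touched_def)
  next
    case False
    then have "\<phi> x = Inr (\<psi> x)" by (simp add: \<phi>_def)
    then show ?thesis using False x \<psi>(1) a by auto
  qed
  ultimately show "indep X"
    using a unfolding indep_def transversal_indep_def by (intro conjI exI[of _ \<phi>]) auto
qed

lemma indep_singleton: "e \<in> ground \<Longrightarrow> n > 0 \<Longrightarrow> indep {e}"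
  by (simp add: indep_iff)

lemma card_blocks_part:
  "card (X \<inter> (\<Union>i\<in>I. D i)) = (\<Sum>i\<in>touched X. card (X \<inter> D i))"
proof -
  have "X \<inter> (\<Union>i\<in>I. D i) = (\<Union>i\<in>touched X. X \<inter> D i)"
    by (auto simp: touched_def)
  moreover have "card (\<Union>i\<in>touched X. X \<inter> D i) = (\<Sum>i\<in>touched X. card (X \<inter> D i))"
    using finite_D block_unique
    by (intro card_UN_disjoint[OF finite_touched]) (auto simp: touched_def)
  ultimately show ?thesis by simp
qed

lemma card_split:
  assumes "X \<subseteq> ground"
  shows "card X = card (X \<inter> C) + card (X \<inter> (\<Union>i\<in>I. D i))"
proof -
  have "X = (X \<inter> C) \<union> (X \<inter> (\<Union>i\<in>I. D i))" using assms by (auto simp: ground_def)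
  moreover have "(X \<inter> C) \<inter> (X \<inter> (\<Union>i\<in>I. D i)) = {}" using disjoint_C_D by auto
  ultimately show ?thesis
    using card_Un_disjoint finite_subset[OF assms finite_ground] by (metis finite_Int)
qed

lemma card_touched_le: "card (touched X) \<le> card (X \<inter> (\<Union>i\<in>I. D i))"
proof -
  have "card (touched X) = (\<Sum>i\<in>touched X. 1)" by simp
  also have "\<dots> \<le> (\<Sum>i\<in>touched X. card (X \<inter> D i))"
    using finite_D by (intro sum_mono) (auto simp: touched_def Suc_le_eq card_gt_0_iff)
  finally show ?thesis by (simp add: card_blocks_part)
qed

lemma indep_card_Int_C: "indep X \<Longrightarrow> card (X \<inter> C) \<le> n"
  using card_split[of X] card_touched_le[of X] by (auto simp: indep_iff)

text \<open>Each independent set holds at most \<open>n\<close> of the \<open>k * n\<close> elements of \<open>C\<close>. Conversely, \<open>k\<close> classes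
  that each take at most one element of every block and at most \<open>n\<close> elements of \<open>C\<close> are
  independent.\<close>

lemma chromatic_number_eq:
  assumes "n > 0" and cC: "card C = k * n" and cD: "\<And>i. i \<in> I \<Longrightarrow> card (D i) = k"
  shows "chromatic_number ground indep = k"
  unfolding chromatic_number_def
proof (rule Least_equality)
  have lower: "k \<le> card P" if P: "partition_on ground P" "\<forall>X\<in>P. indep X" "finite P" for P
  proof -
    have "C = (\<Union>X\<in>P. X \<inter> C)" using P(1) by (auto simp: partition_on_def ground_def)
    then have "card C \<le> (\<Sum>X\<in>P. card (X \<inter> C))" using card_UN_le[OF P(3)] by metis
    also have "\<dots> \<le> card P * n"
      using sum_bounded_above[of P "\<lambda>X. card (X \<inter> C)" n] indep_card_Int_C P(2) by auto
    finally show ?thesis using cC \<open>n > 0\<close> by simp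
  qed
  then show "k \<le> m"
    if "\<exists>P. partition_on ground P \<and> (\<forall>X\<in>P. indep X) \<and> finite P \<and> card P = m" for m
    using that by blast
  \<comment> \<open>Numbering \<open>C\<close> from 0 and dividing by \<open>n\<close> cuts it into \<open>k\<close> parts of size \<open>n\<close>.\<close>
  obtain f where f: "bij_betw f C {..<k * n}"
    using finite_same_card_bij[of C "{..<k * n}"] finite_C cC by auto
  have "\<forall>i\<in>I. \<exists>g. bij_betw g (D i) {..<k}"
    using finite_same_card_bij[of _ "{..<k}"] finite_D cD by (metis card_lessThan finite_lessThan)
  then obtain g where g: "\<And>i. i \<in> I \<Longrightarrow> bij_betw (g i) (D i) {..<k}" by metis
  define col where "col x = (if x \<in> C then f x div n else g (THE i. i \<in> I \<and> x \<in> D i) x)" for x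
  have colD: "col x = g i x" if "i \<in> I" "x \<in> D i" for i x
  proof -
    have "(THE i. i \<in> I \<and> x \<in> D i) = i" using that block_unique by blast
    then show ?thesis using that disjoint_C_D by (auto simp: col_def)
  qed
  have col_less: "col x < k" if x: "x \<in> ground" for x
  proof (cases "x \<in> C")
    case True
    then have "f x < k * n" using f by (auto simp: bij_betw_def)
    then show ?thesis using True by (simp add: col_def less_mult_imp_div_less)
  next
    case False
    then obtain i where i: "i \<in> I" "x \<in> D i" using x by (auto simp: ground_def)
    then show ?thesis using colD[OF i] g[OF i(1)] by (auto simp: bij_betw_def)
  qed
  define fibre where "fibre j = {x \<in> ground. col x = j}" for j
  \<comment> \<open>The empty set is removed to get a partition; the lower bound shows that still \<open>k\<close> classes remain.\<close>
  let ?P = "fibre ` {..<k} - {{}}"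
  have "indep (fibre j)" for j
  proof -
    have "card (fibre j \<inter> C) \<le> card {j * n..<j * n + n}"
    proof (rule card_inj_on_le[of f])
      show "inj_on f (fibre j \<inter> C)" using f by (auto simp: bij_betw_def inj_on_def)
      show "f ` (fibre j \<inter> C) \<subseteq> {j * n..<j * n + n}"
      proof (rule image_subsetI)
        fix x assume "x \<in> fibre j \<inter> C"
        then have "f x div n = j" by (auto simp: fibre_def col_def)
        then have "f x = j * n + f x mod n" by (metis div_mult_mod_eq)
        then show "f x \<in> {j * n..<j * n + n}"
          using mod_less_divisor[OF \<open>n > 0\<close>, of "f x"] by (simp del: mod_less_divisor)
      qed
    qed simp
    moreover have "card (fibre j \<inter> (\<Union>i\<in>I. D i)) \<le> (\<Sum>i\<in>touched (fibre j). 1)"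
      unfolding card_blocks_part
    proof (rule sum_mono)
      fix i assume "i \<in> touched (fibre j)"
      then have i: "i \<in> I" by (simp add: touched_def)
      show "card (fibre j \<inter> D i) \<le> 1"
        using g[OF i] colD[OF i] finite_D[OF i]
        by (auto simp: card_le_Suc0_iff_eq fibre_def bij_betw_def inj_on_def)
    qed
    ultimately show ?thesis
      using card_split[of "fibre j"] by (auto simp: indep_iff fibre_def)
  qed
  moreover have part: "partition_on ground ?P"
    using col_less by (auto simp: partition_on_def disjoint_def fibre_def)
  moreover have "card ?P \<le> k"
    by (metis Diff_subset card_image_le card_lessThan card_mono finite_imageI finite_lessThan le_trans)
  ultimately show "\<exists>P. partition_on ground P \<and> (\<forall>X\<in>P. indep X) \<and> finite P \<and> card P = k"
    using lower[of ?P] by (intro exI[of _ ?P]) (auto intro!: antisym)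
qed


section \<open>Waste in the colouring game\<close>

text \<open>The set \<open>hits h\<close> counts each colour once in each block where it occurs. The waste of a
  position is \<open>card (blocks_part h) - card (hits h)\<close>, the number of coloured elements of blocks
  that repeat a colour of their block. Below it always appears with the subtraction moved to the
  other side of the inequality.\<close>

definition hits :: "('a \<times> 'c) list \<Rightarrow> ('i \<times> 'c) set" where
  "hits h = {(i, a). i \<in> I \<and> (\<exists>e\<in>D i. (e, a) \<in> set h)}"

abbreviation blocks_part :: "('a \<times> 'c) list \<Rightarrow> 'a set" where
  "blocks_part h \<equiv> coloured h \<inter> (\<Union>i\<in>I. D i)"

lemma hits_fibre: "{i. (i, a) \<in> hits h} = touched (colour_class h a)"
  by (auto simp: hits_def touched_def colour_class_def)

lemma hits_subset: "hits h \<subseteq> I \<times> snd ` set h"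
  by (force simp: hits_def)

lemma finite_hits: "finite (hits h)"
  by (rule finite_subset[OF hits_subset]) (simp add: finite_I)

lemma hits_snoc: "hits (h @ [m]) = hits h \<union> {i \<in> I. fst m \<in> D i} \<times> {snd m}"
  by (cases m) (auto simp: hits_def)

lemma block_indices: "i \<in> I \<Longrightarrow> e \<in> D i \<Longrightarrow> {i \<in> I. e \<in> D i} = {i}"
  using block_unique by blast

lemma block_indices_C: "e \<in> C \<Longrightarrow> {i \<in> I. e \<in> D i} = {}"
  using disjoint_C_D by blast

text \<open>A move in \<open>C\<close> changes neither number. A move in a block adds one element to
  \<open>blocks_part\<close> and at most one pair to \<open>hits\<close>, since the blocks are disjoint.\<close>

lemma waste_mono:
  assumes "legal_move ground indep K h m"
  shows "card (blocks_part h) + card (hits (h @ [m])) \<le> card (blocks_part (h @ [m])) + card (hits h)"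
proof (cases "fst m \<in> C")
  case True
  then have "hits (h @ [m]) = hits h" "blocks_part (h @ [m]) = blocks_part h"
    using block_indices_C[OF True] disjoint_C_D by (auto simp: hits_snoc)
  then show ?thesis by simp
next
  case False
  then obtain i where i: "i \<in> I" "fst m \<in> D i"
    using assms by (auto simp: legal_move_iff ground_def)
  have "hits (h @ [m]) = insert (i, snd m) (hits h)"
    using block_indices[OF i] by (simp add: hits_snoc)
  then have "card (hits (h @ [m])) \<le> Suc (card (hits h))"
    by (simp add: card_insert_if finite_hits)
  moreover have "blocks_part (h @ [m]) = insert (fst m) (blocks_part h)" using i by auto
  then have "card (blocks_part (h @ [m])) = Suc (card (blocks_part h))"
    using assms by (simp add: legal_move_iff)
  ultimately show ?thesis by simp
qed

lemma length_eq_parts: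
  "proper_history ground indep K h \<Longrightarrow> length h = card (coloured h \<inter> C) + card (blocks_part h)"
  using card_split[of "coloured h"] proper_history_card_coloured[of ground indep K h]
  by (simp add: proper_history_def)

lemma card_eq_sum_fibres:
  assumes "finite K" "finite R" "snd ` R \<subseteq> K"
  shows "card R = (\<Sum>a\<in>K. card {x. (x, a) \<in> R})"
proof -
  have "prod.swap ` R = (SIGMA a:K. {x. (x, a) \<in> R})" using assms(3) by force
  moreover have "card (prod.swap ` R) = card R"
    by (rule card_image) (auto simp: inj_on_def)
  moreover have "finite {x. (x, a) \<in> R}" for a
    by (rule finite_subset[OF _ finite_imageI[OF assms(2), of fst]]) force
  then have "card (SIGMA a:K. {x. (x, a) \<in> R}) = (\<Sum>a\<in>K. card {x. (x, a) \<in> R})"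
    using assms(1) by (intro card_SigmaI) auto
  ultimately show ?thesis by metis
qed

lemma length_eq_sum_classes:
  assumes "finite K" "proper_history ground indep K h"
  shows "length h = (\<Sum>a\<in>K. card (colour_class h a))"
  using card_eq_sum_fibres[OF assms(1), of "set h"] assms(2) proper_history_card_set[OF assms(2)]
  by (simp add: proper_history_def colour_class_def)

lemma card_hits_eq_sum:
  assumes "finite K" "proper_history ground indep K h"
  shows "card (hits h) = (\<Sum>a\<in>K. card (touched (colour_class h a)))"
  using card_eq_sum_fibres[OF assms(1) finite_hits, of h] hits_subset[of h] assms(2)
  by (force simp: proper_history_def hits_fibre)

text \<open>The bound of \<open>indep_iff\<close>, summed over all colours.\<close>

lemma length_le_capacity:
  assumes "finite K" "proper_history ground indep K h"
  shows "length h \<le> card K * n + card (hits h)"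
proof -
  have "length h \<le> (\<Sum>a\<in>K. n + card (touched (colour_class h a)))"
    unfolding length_eq_sum_classes[OF assms]
    using assms(2) by (intro sum_mono) (metis card.empty indep_iff le0 proper_history_def)
  then show ?thesis by (simp add: sum.distrib card_hits_eq_sum[OF assms])
qed

lemma exists_nonfull_colour:
  assumes "finite K" "proper_history ground indep K h"
    and "length h < card K * n + card (hits h)"
  obtains a where "a \<in> K" "card (colour_class h a) < n + card (touched (colour_class h a))"
proof (rule ccontr)
  assume "\<not> thesis"
  then have "(\<Sum>a\<in>K. n + card (touched (colour_class h a))) \<le> (\<Sum>a\<in>K. card (colour_class h a))"
    using that by (intro sum_mono) (meson not_le)
  then show False
    using assms(3)
    by (simp add: sum.distrib card_hits_eq_sum[OF assms(1,2)] length_eq_sum_classes[OF assms(1,2)])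
qed

text \<open>In a complete position all of \<open>C\<close> is coloured and the claim is the capacity bound. Under a
  winning strategy every position extends to a complete one, and the waste does not decrease on
  the way, so the bound holds from the outset.\<close>

lemma waste_bound:
  assumes fin: "finite K" and win: "winning_strategy ground indep K \<sigma>"
    and h: "h \<in> plays ground indep K \<sigma>"
  shows "card (blocks_part h) + card C \<le> card K * n + card (hits h)"
  using h
proof (induction "card ground - length h" arbitrary: h rule: less_induct)
  case less
  note p = proper_history_plays[OF less.prems]
  show ?case
  proof (cases "coloured h = ground")
    case True
    then have "coloured h \<inter> C = C" by (auto simp: ground_def)
    then show ?thesis
      using length_le_capacity[OF fin p] length_eq_parts[OF p] by simp
  next
    case False
    then obtain m where m: "legal_move ground indep K h m" "h @ [m] \<in> plays ground indep K \<sigma>"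
      using winning_strategy_extend[OF win less.prems] by blast
    have "coloured h \<subset> ground" using False p by (auto simp: proper_history_def)
    then have "length h < card ground"
      using psubset_card_mono[OF finite_ground] proper_history_card_coloured[OF p] by metis
    then have "card (blocks_part (h @ [m])) + card C \<le> card K * n + card (hits (h @ [m]))"
      by (intro less.hyps[OF _ m(2)]) simp
    then show ?thesis using waste_mono[OF m(1)] by linarith
  qed
qed

text \<open>A colour whose class \<open>X\<close> satisfies \<open>card X < n + card (touched X)\<close> still has a free copy of the
  ground set, which can take the new element.\<close>

lemma legal_move_nonfull:
  assumes "e \<in> ground" "e \<notin> coloured h" "a \<in> K" "proper_history ground indep K h"
    and "card (colour_class h a) < n + card (touched (colour_class h a))"
  shows "legal_move ground indep K h (e, a)"
proof -
  have sub: "colour_class h a \<subseteq> coloured h" by (force simp: colour_class_def)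
  have "touched (colour_class h a) \<subseteq> touched (insert e (colour_class h a))"
    by (auto simp: touched_def)
  then have "card (touched (colour_class h a)) \<le> card (touched (insert e (colour_class h a)))"
    by (intro card_mono finite_touched)
  moreover have "card (insert e (colour_class h a)) \<le> Suc (card (colour_class h a))"
    using finite_subset[OF sub] by (simp add: card_insert_if)
  moreover have "colour_class h a \<subseteq> ground" using sub assms(4) by (auto simp: proper_history_def)
  ultimately show ?thesis
    using assms by (simp add: legal_move_iff colour_class_snoc indep_iff)
qed

section \<open>The strategy of Bob\<close>

text \<open>A set \<open>S\<close> of pairs records the blocks that Bob started, with their starting colours.\<close>

definition open_part :: "('a \<times> 'c) list \<Rightarrow> ('i \<times> 'c) set \<Rightarrow> ('i \<times> 'c) set" where
  "open_part h S = {p \<in> S. \<not> D (fst p) \<subseteq> coloured h}"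

text \<open>The invariant of the strategy after \<open>b\<close> moves of Bob: apart from one start per recorded block,
  each of his moves was waste, and the blocks of \<open>S\<close> that are not completely coloured have
  different starting colours.\<close>

definition bob_account :: "('a \<times> 'c) list \<Rightarrow> nat \<Rightarrow> ('i \<times> 'c) set \<Rightarrow> bool" where
  "bob_account h b S \<longleftrightarrow>
     S \<subseteq> hits h \<and> inj_on fst S \<and> inj_on snd (open_part h S) \<and>
     b + card (hits h) \<le> card (blocks_part h) + card S"

text \<open>No legal move can damage the account: it never shrinks the coloured set, the waste or the
  set of hits.\<close>

lemma bob_account_snoc:
  assumes "bob_account h b S" "legal_move ground indep K h m"
  shows "bob_account (h @ [m]) b S"
proof -
  have "open_part (h @ [m]) S \<subseteq> open_part h S" by (auto simp: open_part_def)
  then have "inj_on snd (open_part (h @ [m]) S)"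
    using assms(1) inj_on_subset by (auto simp: bob_account_def)
  moreover have "S \<subseteq> hits (h @ [m])" using assms(1) by (auto simp: bob_account_def hits_snoc)
  ultimately show ?thesis
    using assms(1) waste_mono[OF assms(2)] by (simp add: bob_account_def)
qed

lemma bob_account_repeat:
  assumes J: "bob_account h b S" and m: "legal_move ground indep K h (e, a)"
    and e: "i \<in> I" "e \<in> D i" "(i, a) \<in> hits h"
  shows "bob_account (h @ [(e, a)]) (Suc b) S"
proof -
  have "hits (h @ [(e, a)]) = hits h"
    using block_indices[OF e(1,2)] e(3) by (auto simp: hits_snoc)
  moreover have "blocks_part (h @ [(e, a)]) = insert e (blocks_part h)" using e by auto
  then have "card (blocks_part (h @ [(e, a)])) = Suc (card (blocks_part h))"
    using m by (simp add: legal_move_iff)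
  ultimately show ?thesis
    using bob_account_snoc[OF J m] J by (simp add: bob_account_def)
qed

lemma bob_account_start:
  assumes J: "bob_account h b S" and m: "legal_move ground indep K h (e, a)"
    and e: "i \<in> I" "e \<in> D i" "D i \<inter> coloured h = {}"
    and a: "a \<notin> snd ` open_part h S"
  shows "bob_account (h @ [(e, a)]) (Suc b) (insert (i, a) S)"
proof -
  let ?h = "h @ [(e, a)]" and ?S = "insert (i, a) S"
  have new: "(i, c) \<notin> hits h" for c using e(3) by (force simp: hits_def)
  have iS: "i \<notin> fst ` S" using J new by (force simp: bob_account_def)
  have hits: "hits ?h = insert (i, a) (hits h)"
    using block_indices[OF e(1,2)] by (simp add: hits_snoc)
  have "card (hits ?h) = Suc (card (hits h))" by (metis hits new finite_hits card_insert_disjoint)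
  moreover have "blocks_part ?h = insert e (blocks_part h)" using e by auto
  then have "card (blocks_part ?h) = Suc (card (blocks_part h))"
    using m by (simp add: legal_move_iff)
  moreover have "finite S" using J finite_hits finite_subset by (auto simp: bob_account_def)
  then have "card ?S = Suc (card S)" using iS by (subst card_insert_disjoint) force+
  moreover have "inj_on snd (insert (i, a) (open_part h S))"
    using J a by (auto simp: bob_account_def)
  then have "inj_on snd (open_part ?h ?S)"
    by (rule inj_on_subset) (auto simp: open_part_def)
  moreover have "inj_on fst ?S" using J iS by (auto simp: bob_account_def)
  moreover have "?S \<subseteq> hits ?h" using J hits by (auto simp: bob_account_def)
  ultimately show ?thesis
    using J by (simp add: bob_account_def)
qed

text \<open>A completely coloured block contributes \<open>k\<close> elements, any other touched block at least
  one.\<close>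

lemma full_blocks_count:
  assumes cD: "\<And>i. i \<in> I \<Longrightarrow> card (D i) = k"
    and F: "F \<subseteq> touched X" "\<And>i. i \<in> F \<Longrightarrow> D i \<subseteq> X"
  shows "k * card F + card (touched X) \<le> card (X \<inter> (\<Union>i\<in>I. D i)) + card F"
proof -
  have "k * card F = (\<Sum>i\<in>F. card (X \<inter> D i))"
    using F cD by (simp add: Int_absorb1 subset_iff touched_def)
  moreover have "card (touched X - F) \<le> (\<Sum>i\<in>touched X - F. card (X \<inter> D i))"
  proof -
    have "(\<Sum>i\<in>touched X - F. 1) \<le> (\<Sum>i\<in>touched X - F. card (X \<inter> D i))"
      using finite_D by (intro sum_mono) (auto simp: touched_def Suc_le_eq card_gt_0_iff)
    then show ?thesis by simp
  qed
  moreover have "card (touched X) = card (touched X - F) + card F"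
    using card_Diff_subset[OF finite_subset[OF F(1) finite_touched] F(1)]
      card_mono[OF finite_touched F(1)] by simp
  ultimately show ?thesis
    using sum.subset_diff[OF F(1) finite_touched, of "\<lambda>i. card (X \<inter> D i)"]
    by (simp add: card_blocks_part)
qed

end

text \<open>
In the next two lemmas \<open>c\<close> is the number of colours, \<open>b\<close> the number of moves of Bob, \<open>d\<close> the number
of coloured elements of blocks, \<open>\<tau>\<close> the number of hits and \<open>t\<close> the number of touched blocks, while
\<open>p\<close> and \<open>q\<close> count the started blocks that are completely coloured and those that are not.

The waste \<open>d - \<tau>\<close> is at most \<open>(k - 2) * n\<close>, so \<open>b \<le> (k - 2) * n + p + q\<close>. Inserting this into
\<open>(k - 1) * p + t \<le> d \<le> 2 * b + 1\<close> gives \<open>(k - 3) * p + t \<le> 2 * (k - 2) * n + 2 * q + 1\<close>, and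
\<open>q < n\<close>.
\<close>

lemma fresh_block_arith:
  fixes k n c p q t b d \<tau> :: nat
  assumes "k \<ge> 3" "n = 2 * k - 1" "c \<le> 2 * k - 2" "q \<le> c"
    and "k * p + t \<le> d + p" "b + \<tau> \<le> d + (p + q)" "d + k * n \<le> c * n + \<tau>" "d \<le> 2 * b + 1"
  shows "t < 3 * (k * n)"
proof -
  obtain j where j: "k = j + 3" using assms(1) by (metis add.commute le_Suc_ex)
  have n: "n = 2 * j + 5" using assms(2) j by simp
  have "c * n \<le> (2 * j + 4) * n" using assms(3) j by (intro mult_right_mono) auto
  then have "d + (j + 3) * n \<le> (2 * j + 4) * n + \<tau>" using assms(7) unfolding j by linarith
  then have "d \<le> (j + 1) * n + \<tau>" by (simp add: algebra_simps)
  then have "b \<le> (j + 1) * n + p + q" using assms(6) by linarith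
  then have "(j + 3) * p + t \<le> 2 * ((j + 1) * n) + 2 * p + 2 * q + 1 + p"
    using assms(5,8) j by simp
  then have "t \<le> 2 * ((j + 1) * n) + 2 * q + 1" by (simp add: algebra_simps)
  then have "t \<le> 2 * ((j + 1) * n) + 2 * n" using assms(3,4) n j by linarith
  moreover have "0 < n" using n by simp
  then have "2 * ((j + 1) * n) + 2 * n < 3 * ((j + 3) * n)" by (simp add: algebra_simps)
  ultimately show ?thesis using j by simp
qed

text \<open>Since \<open>d + k * n\<close> would be the length of the history if \<open>C\<close> were completely coloured, the
  conclusion says that this cannot happen within \<open>2 * b + 1\<close> moves. Suppose that it does. Multiplying
  \<open>b \<le> (k - 2) * n + p + q\<close> by \<open>k\<close> and using \<open>k * p + q \<le> d \<le> 2 * b + 1 - k * n\<close> gives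
  \<open>(k - 2) * b \<le> k * (k - 3) * n + 1 + (k - 1) * q\<close>. On the other hand \<open>b \<ge> k * n - 1\<close>, because Bob moves
  only in blocks, that is, \<open>b \<le> d\<close>. Together, \<open>k * n \<le> k - 1 + (k - 1) * q\<close>, and with \<open>q \<le> 2 * k - 2\<close>
  the right-hand side is at most \<open>(k - 1) * n\<close>.\<close>

lemma free_part_arith:
  fixes k n c p q t b d \<tau> :: nat
  assumes "k \<ge> 3" "n = 2 * k - 1" "c \<le> 2 * k - 2" "q \<le> c"
    and "k * p + t \<le> d + p" "b + \<tau> \<le> d + (p + q)" "d + k * n \<le> c * n + \<tau>"
    and "p + q \<le> t" "b \<le> d"
  shows "2 * b + 1 < d + k * n"
proof (rule ccontr)
  assume "\<not> ?thesis"
  then have L: "d + k * n \<le> 2 * b + 1" by simp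
  obtain j where j: "k = j + 3" using assms(1) by (metis add.commute le_Suc_ex)
  have n: "n = 2 * j + 5" using assms(2) j by simp
  have "c * n \<le> (2 * j + 4) * n" using assms(3) j by (intro mult_right_mono) auto
  then have "d + (j + 3) * n \<le> (2 * j + 4) * n + \<tau>" using assms(7) unfolding j by linarith
  then have "d \<le> (j + 1) * n + \<tau>" by (simp add: algebra_simps)
  then have "b \<le> (j + 1) * n + p + q" using assms(6) by linarith
  then have "(j + 3) * b \<le> (j + 3) * ((j + 1) * n + p + q)" by (rule mult_left_mono) simp
  then have "(j + 3) * b \<le> (j + 3) * ((j + 1) * n) + (j + 3) * p + (j + 3) * q"
    by (simp add: algebra_simps)
  moreover have "(j + 3) * p + q \<le> d" using assms(5,8) j by simp
  ultimately have "(j + 3) * b + q \<le> (j + 3) * ((j + 1) * n) + d + (j + 3) * q" by linarith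
  then have 1: "(j + 1) * b + q + (j + 3) * n \<le> (j + 3) * ((j + 1) * n) + 1 + (j + 3) * q"
    using L j by (simp add: algebra_simps)
  have "(j + 1) * ((j + 3) * n) \<le> (j + 1) * (b + 1)"
    using L assms(9) j by (intro mult_left_mono) auto
  then have "q + (j + 3) * n \<le> 1 + (j + 3) * q + (j + 1)"
    using 1 by (simp add: algebra_simps)
  moreover have "(j + 2) * q \<le> (j + 2) * (2 * j + 4)"
    using assms(3,4) j by (intro mult_left_mono) auto
  ultimately show False using n by (simp add: algebra_simps)
qed


text \<open>The assumptions of this locale are to be refuted: Alice has a winning strategy with at most
  \<open>2 * k - 2\<close> colours.\<close>

locale bob_against_winning_strategy = block_matroid C D I n
  for C :: "'a set" and D :: "'i \<Rightarrow> 'a set" and I n +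
  fixes k :: nat and K :: "'c set" and \<sigma> :: "('a \<times> 'c) list \<Rightarrow> 'a \<times> 'c"
  assumes k: "k \<ge> 3" and n: "n = 2 * k - 1"
    and card_C: "card C = k * n" and card_D: "i \<in> I \<Longrightarrow> card (D i) = k"
    and card_I: "card I = 3 * (k * n)"
    and finite_K: "finite K" and card_K: "card K \<le> 2 * k - 2"
    and winning: "winning_strategy ground indep K \<sigma>"
begin

text \<open>The bound on \<open>length h\<close> says that Alice has made at most one move more than Bob. The two
  conclusions keep the strategy alive: there is a block left to start, and the game is not over.\<close>

lemma bob_account_counts:
  assumes h: "h \<in> plays ground indep K \<sigma>" and J: "bob_account h b S" and len: "length h \<le> 2 * b + 1"
  shows "card (touched (coloured h)) < card I" and "card (coloured h \<inter> C) < card C"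
proof -
  note p = proper_history_plays[OF h]
  have S: "S \<subseteq> hits h" "inj_on fst S" "inj_on snd (open_part h S)"
    and acc: "b + card (hits h) \<le> card (blocks_part h) + card S"
    using J by (auto simp: bob_account_def)
  have fS: "finite S" using S(1) finite_hits finite_subset by blast
  have O: "open_part h S \<subseteq> S" by (auto simp: open_part_def)
  have fO: "finite (open_part h S)" using O fS finite_subset by blast
  let ?F = "fst ` (S - open_part h S)"
  have sub: "fst ` S \<subseteq> touched (coloured h)"
    using S(1) by (force simp: hits_def touched_def)
  have F: "card ?F = card (S - open_part h S)"
    using S(2) by (intro card_image) (auto intro: inj_on_subset)
  then have cS: "card S = card ?F + card (open_part h S)"
    using card_Diff_subset[OF fO O] card_mono[OF fS O] by simp
  have "k * card ?F + card (touched (coloured h)) \<le> card (blocks_part h) + card ?F"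
    by (rule full_blocks_count) (use card_D sub in \<open>auto simp: open_part_def\<close>)
  note 1 = this
  have 2: "card ?F + card (open_part h S) \<le> card (touched (coloured h))"
    using card_mono[OF finite_touched sub] card_image[OF S(2)] cS by simp
  have "snd ` open_part h S \<subseteq> K"
  proof -
    have "snd ` hits h \<subseteq> snd ` set h" using hits_subset[of h] by auto
    moreover have "snd ` set h \<subseteq> K" using p by (simp add: proper_history_def)
    moreover have "snd ` open_part h S \<subseteq> snd ` hits h"
      by (intro image_mono order_trans[OF O S(1)])
    ultimately show ?thesis by (meson order_trans)
  qed
  then have 3: "card (open_part h S) \<le> card K"
    using card_inj_on_le[OF S(3) _ finite_K] by simp
  have 4: "card (blocks_part h) + k * n \<le> card K * n + card (hits h)"
    using waste_bound[OF finite_K winning h] card_C by simp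
  note len' = length_eq_parts[OF p]
  have "card (touched (coloured h)) < 3 * (k * n)"
    using len len' by (intro fresh_block_arith[OF k n card_K 3 1 acc[unfolded cS] 4]) simp
  then show "card (touched (coloured h)) < card I" using card_I by simp
  have "card S \<le> card (hits h)" using S(1) finite_hits card_mono by blast
  then have "b \<le> card (blocks_part h)" using acc by simp
  then have "2 * b + 1 < card (blocks_part h) + k * n"
    by (rule free_part_arith[OF k n card_K 3 1 acc[unfolded cS] 4 2])
  then show "card (coloured h \<inter> C) < card C" using len len' card_C by simp
qed

text \<open>Either some legal move repeats a colour in its block, or Bob starts an untouched block with a
  colour that is not full. Such a colour exists because \<open>C\<close> is not completely coloured, so the capacity
  bound is not attained. It is not the starting colour of any open block in \<open>S\<close>, since otherwise
  repeating it there would be legal.\<close>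

lemma bob_move:
  assumes h: "h \<in> plays ground indep K \<sigma>" and J: "bob_account h b S" and len: "length h = 2 * b + 1"
  obtains m S' where "legal_move ground indep K h m" "bob_account (h @ [m]) (Suc b) S'"
proof (cases "\<exists>i e a. i \<in> I \<and> e \<in> D i \<and> (i, a) \<in> hits h \<and> legal_move ground indep K h (e, a)")
  case True
  then show ?thesis using bob_account_repeat[OF J] that by blast
next
  case no_repeat: False
  note p = proper_history_plays[OF h]
  have "length h \<le> 2 * b + 1" using len by simp
  note counts = bob_account_counts[OF h J this]
  have "length h < card K * n + card (hits h)"
    using length_eq_parts[OF p] counts(2) waste_bound[OF finite_K winning h] by simp
  then obtain a where a: "a \<in> K" "card (colour_class h a) < n + card (touched (colour_class h a))"
    using exists_nonfull_colour[OF finite_K p] by blast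
  have "\<not> I \<subseteq> touched (coloured h)"
    using counts(1) card_mono[OF finite_touched] not_le by blast
  then obtain i where i: "i \<in> I" "D i \<inter> coloured h = {}" by (auto simp: touched_def)
  have "D i \<noteq> {}" using card_D[OF i(1)] k by auto
  then obtain e where e: "e \<in> D i" by blast
  have nonfull: "legal_move ground indep K h (x, a)" if "j \<in> I" "x \<in> D j" "x \<notin> coloured h" for j x
    using that a p by (intro legal_move_nonfull) (auto simp: ground_def)
  have m: "legal_move ground indep K h (e, a)" using nonfull i e by blast
  have "a \<notin> snd ` open_part h S"
  proof
    assume "a \<in> snd ` open_part h S"
    then obtain q where "q \<in> open_part h S" "a = snd q" by blast
    then have q: "(fst q, a) \<in> S" "\<not> D (fst q) \<subseteq> coloured h" by (simp_all add: open_part_def)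
    then have hit: "(fst q, a) \<in> hits h" using J unfolding bob_account_def by (meson subsetD)
    then have I: "fst q \<in> I" by (simp add: hits_def)
    obtain x where x: "x \<in> D (fst q)" "x \<notin> coloured h" using q(2) by (meson subsetI)
    show False using no_repeat I x(1) hit nonfull[OF I x] by iprover
  qed
  then show ?thesis by (rule that[OF m bob_account_start[OF J m i(1) e i(2)]])
qed

text \<open>Alice must move because \<open>C\<close> is not completely coloured, and Bob answers with \<open>bob_move\<close>.\<close>

lemma long_plays: "\<exists>h S. h \<in> plays ground indep K \<sigma> \<and> length h = 2 * b \<and> bob_account h b S"
proof (induction b)
  case 0
  have "bob_account [] 0 {}" by (simp add: bob_account_def open_part_def hits_def)
  then show ?case using plays.start by (intro exI[of _ "[]"]) auto
next
  case (Suc b)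
  then obtain h S where h: "h \<in> plays ground indep K \<sigma>" "length h = 2 * b" "bob_account h b S" by blast
  have "card (coloured h \<inter> C) < card C" using bob_account_counts(2)[OF h(1,3)] h(2) by simp
  then have "coloured h \<noteq> ground" by (auto simp: ground_def Int_absorb1)
  then have A: "legal_move ground indep K h (\<sigma> h)"
    using winning h by (auto simp: winning_strategy_def)
  let ?h = "h @ [\<sigma> h]"
  have h1: "?h \<in> plays ground indep K \<sigma>" using plays.alice[OF h(1) _ A] h(2) by simp
  obtain m S' where m: "legal_move ground indep K ?h m" "bob_account (?h @ [m]) (Suc b) S'"
    using bob_move[OF h1 bob_account_snoc[OF h(3) A]] h(2) by auto
  have "?h @ [m] \<in> plays ground indep K \<sigma>" using plays.bob[OF h1 _ m(1)] h(2) by simp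
  then show ?case using m(2) h(2) by (intro exI[of _ "?h @ [m]"]) auto
qed

lemma no_winning_strategy: False
proof -
  obtain h where h: "h \<in> plays ground indep K \<sigma>" "length h = 2 * Suc (card ground)"
    using long_plays by blast
  note p = proper_history_plays[OF h(1)]
  have "length h \<le> card ground"
    using proper_history_card_coloured[OF p] p card_mono[OF finite_ground]
    by (metis proper_history_def)
  then show False using h(2) by simp
qed

end

theorem theorem3p5:
  fixes k :: nat and C :: "'a set" and D :: "nat \<Rightarrow> 'a set" and E :: "'a set"
    and M :: "'a set \<Rightarrow> bool"
  assumes "k \<ge> 3"
    and "finite C" and "card C = k * (2 * k - 1)"
    and "\<And>i. i \<in> {1..3 * k * (2 * k - 1)} \<Longrightarrow> finite (D i) \<and> card (D i) = k"
    and "disjoint_family_on D {1..3 * k * (2 * k - 1)}"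
    and "\<And>i. i \<in> {1..3 * k * (2 * k - 1)} \<Longrightarrow> C \<inter> D i = {}"
    and "E = C \<union> (\<Union>i\<in>{1..3 * k * (2 * k - 1)}. D i)"
    and "M = transversal_indep E ({1..3 * k * (2 * k - 1)} <+> {1..2 * k - 1})
               (case_sum D (\<lambda>_::nat. E))"
  shows "chromatic_number E M = k \<and> game_chromatic_number E M \<ge> 2 * k - 1"
proof -
  interpret block_matroid C D "{1..3 * k * (2 * k - 1)}" "2 * k - 1"
    using assms(2,4,5,6) by unfold_locales simp_all
  have E: "E = ground" unfolding ground_def by (rule assms(7))
  have M: "M = indep" unfolding indep_def E[symmetric] by (rule assms(8))
  have pos: "2 * k - 1 > 0" using assms(1) by simp
  have "chromatic_number E M = k"
    unfolding E M by (rule chromatic_number_eq[OF pos assms(3)]) (rule conjunct2[OF assms(4)])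
  moreover have "2 * k - 1 \<le> game_chromatic_number E M"
  proof -
    let ?win = "\<lambda>c. \<exists>K :: nat set. finite K \<and> card K = c \<and> (\<exists>\<sigma>. winning_strategy ground indep K \<sigma>)"
    have lower: "2 * k - 1 \<le> c" if c: "?win c" for c
    proof (rule ccontr)
      assume "\<not> ?thesis"
      then have "c \<le> 2 * k - 2" by simp
      moreover obtain K :: "nat set" and \<sigma> where
        K: "finite K" "card K = c" "winning_strategy ground indep K \<sigma>" using c by blast
      ultimately interpret bob_against_winning_strategy C D "{1..3 * k * (2 * k - 1)}" "2 * k - 1" k K \<sigma>
        by unfold_locales (use assms(1,3,4) in simp_all)
      show False by (rule no_winning_strategy)
    qed
    have "\<exists>\<sigma>. winning_strategy ground indep {..<card ground} \<sigma>"
      by (rule winning_strategy_card_colours[of ground indep, OF finite_ground indep_singleton[OF _ pos]])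
    then have "finite {..<card ground} \<and> card {..<card ground} = card ground \<and>
        (\<exists>\<sigma>. winning_strategy ground indep {..<card ground} \<sigma>)" by simp
    then have "?win (card ground)" by (rule exI[where x = "{..<card ground}"])
    then have "?win (LEAST c. ?win c)" by (rule LeastI[of ?win])
    then show ?thesis unfolding game_chromatic_number_def E M by (rule lower)
  qed
  ultimately show ?thesis ..
qed

end
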